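(* Let the ILRFPP model on $\mathbb{Z}^d$ satisfy the standing assumptions, and suppose $\alpha<d/\gamma$. For $x\in\mathbb{Z}^d\setminus\{0\}$ and $t\ge0$ let $$H_x(t):=\inf\{|\pi|:\ \pi\text{ a finite self-avoiding path from }0\text{ to }x,\ W_\pi\le t\},\qquad \inf\varnothing:=\infty.$$ Then almost surely, for every $x\in\mathbb{Z}^d\setminus\{0\}$, $$H_x(0)=\infty,\qquad H_x(t)=2\ \text{ for }0<t<W_{0x},\qquad H_x(t)=1\ \text{ for }t\ge W_{0x}.$$ In particular, (i) the infimum $T(0,x)=0$ is not attained by any finite path, and (ii) for every $t\in(0,W_{0x})$ there are infinitely many distinct $2$-hop paths from $0$ to $x$ of total weight at most $t$.
   Context: Model (inhomogeneous long-range first-passage percolation, ILRFPP). Fix an integer $d\ge1$ and $\alpha>0$; $\|\cdot\|$ is the $\ell_1$ norm on $\mathbb{Z}^d$. The vertex weights $(V_x)_{x\in\mathbb{Z}^d}$ are i.i.d. with the law of a random variable $V$; the edge noises $\omega_{xy}=\omega_{yx}\ge0$, one for every unordered pair $\{x,y\}$ of distinct vertices of $\mathbb{Z}^d$ (all pairs are edges), are i.i.d. with the law of $\omega$, and independent of the vertex weights. The passage time of an edge is $W_{xy}:=\|x-y\|^{\alpha}\,\omega_{xy}/(V_xV_y)$. A path $\pi$ is a finite sequence of distinct vertices; $W_\pi$ is the sum of $W$ over its consecutive edges and $|\pi|$ is its number of edges (hop count). $T(x,y)$ is the infimum of $W_\pi$ over all finite self-avoiding paths $\pi$ from $x$ to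 $y$. Standing assumptions: for fixed $\gamma,\theta,\zeta>0$, $\mathbb{P}(0<V<\infty)=1$ and $\lim_{x\to\infty}\log\mathbb{P}(V\ge x)/\log x=-\gamma$; $\lim_{x\downarrow0}\log\mathbb{P}(\omega\le x)/\log x=\theta$ and $\mathbb{E}\,\omega^{\zeta}<\infty$. *)

theory Defs
  imports "HOL-Probability.Probability" "HOL-Library.Extended_Nat"
begin

text \<open>
  The lattice \<open>\<int>\<^sup>d\<close> is the type \<open>int ^ 'd\<close>, with \<open>d = CARD('d)\<close>. A realisation of the model
  consists of vertex weights \<open>v\<close> and of edge noises \<open>w\<close>; the latter are indexed by
  two-element sets of vertices, so that \<open>w {x, y}\<close> is symmetric in \<open>x\<close> and \<open>y\<close>.
\<close>

definition l1_norm :: "int ^ 'd \<Rightarrow> int" where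
  "l1_norm x = (\<Sum>i\<in>UNIV. \<bar>x $ i\<bar>)"

definition edges :: "(int ^ 'd) set set" where
  "edges = {{x, y} | x y. x \<noteq> y}"

definition edge_time ::
  "real \<Rightarrow> (int ^ 'd \<Rightarrow> real) \<Rightarrow> ((int ^ 'd) set \<Rightarrow> real) \<Rightarrow> int ^ 'd \<Rightarrow> int ^ 'd \<Rightarrow> real" where
  "edge_time \<alpha> v w x y = real_of_int (l1_norm (x - y)) powr \<alpha> * w {x, y} / (v x * v y)"

definition paths :: "int ^ 'd \<Rightarrow> int ^ 'd \<Rightarrow> (int ^ 'd) list set" where
  "paths x y = {p. p \<noteq> [] \<and> distinct p \<and> hd p = x \<and> last p = y}"

definition hop_count :: "(int ^ 'd) list \<Rightarrow> nat" where
  "hop_count p = length p - 1"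

definition path_time ::
  "real \<Rightarrow> (int ^ 'd \<Rightarrow> real) \<Rightarrow> ((int ^ 'd) set \<Rightarrow> real) \<Rightarrow> (int ^ 'd) list \<Rightarrow> real" where
  "path_time \<alpha> v w p = (\<Sum>i<hop_count p. edge_time \<alpha> v w (p ! i) (p ! Suc i))"

text \<open>The infimum is taken in \<open>ereal\<close>, where it is meaningful for every realisation.\<close>

definition first_passage_time ::
  "real \<Rightarrow> (int ^ 'd \<Rightarrow> real) \<Rightarrow> ((int ^ 'd) set \<Rightarrow> real) \<Rightarrow> int ^ 'd \<Rightarrow> int ^ 'd \<Rightarrow> ereal" where
  "first_passage_time \<alpha> v w x y = (INF p\<in>paths x y. ereal (path_time \<alpha> v w p))"

text \<open>In \<open>enat\<close> the infimum of the empty set is \<open>\<infinity>\<close>.\<close>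

definition min_hops ::
  "real \<Rightarrow> (int ^ 'd \<Rightarrow> real) \<Rightarrow> ((int ^ 'd) set \<Rightarrow> real) \<Rightarrow> int ^ 'd \<Rightarrow> real \<Rightarrow> enat" where
  "min_hops \<alpha> v w x t = (INF p\<in>{p \<in> paths 0 x. path_time \<alpha> v w p \<le> t}. enat (hop_count p))"

text \<open>
  \<open>LV\<close> and \<open>L\<omega>\<close> are the common laws of the vertex weights and of the edge noises.
  Assumption \<open>indep\<close> is the joint independence of all vertex weights and all edge noises.
  Since \<open>ln 0 = 0\<close> in HOL and \<open>\<gamma>, \<theta> \<noteq> 0\<close>, the two limit assumptions cannot be met by laws
  whose probabilities \<open>P(V \<ge> x)\<close> (\<open>x\<close> large) or \<open>P(\<omega> \<le> x)\<close> (\<open>x\<close> small) vanish.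
\<close>

locale ilrfpp = prob_space M
  for M :: "'a measure" +
  fixes V :: "int ^ 'd \<Rightarrow> 'a \<Rightarrow> real"
    and \<omega> :: "(int ^ 'd) set \<Rightarrow> 'a \<Rightarrow> real"
    and LV L\<omega> :: "real measure"
    and \<alpha> \<gamma> \<theta> \<zeta> :: real
  assumes indep: "indep_vars (\<lambda>_. borel) (case_sum V \<omega>) (UNIV <+> edges)"
    and law_V: "distr M borel (V x) = LV"
    and law_\<omega>: "e \<in> edges \<Longrightarrow> distr M borel (\<omega> e) = L\<omega>"
    and pos: "\<alpha> > 0" "\<gamma> > 0" "\<theta> > 0" "\<zeta> > 0"
    and V_pos: "AE r in LV. r > 0"
    and \<omega>_nonneg: "AE r in L\<omega>. r \<ge> 0"
    and V_tail: "((\<lambda>r. ln (measure LV {r..}) / ln r) \<longlongrightarrow> - \<gamma>) at_top"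
    and \<omega>_tail: "((\<lambda>r. ln (measure L\<omega> {..r}) / ln r) \<longlongrightarrow> \<theta>) (at_right 0)"
    and \<omega>_moment: "integrable L\<omega> (\<lambda>r. r powr \<zeta>)"

end

theory Submission imports Defs "HOL-Real_Asymp.Real_Asymp"
begin

text \<open>
  A path from \<open>0\<close> to \<open>x\<close> can be made as cheap as desired by going through a single far away vertex
  of very large weight. Call \<open>y\<close> a relay at level \<open>c\<close> if \<open>V\<^sub>y \<ge> c * \<parallel>y\<parallel>\<^sup>\<alpha>\<close> and the noises on
  \<open>{0, y}\<close> and \<open>{y, x}\<close> are at most a fixed constant \<open>K\<close> with \<open>P(\<omega> \<le> K) > 0\<close>. The factor
  \<open>\<parallel>y\<parallel>\<^sup>\<alpha>\<close> in the weight cancels the length penalty of both edges, up to a constant that depends on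
  \<open>x\<close> only, so the path \<open>0, y, x\<close> has total time \<open>O(1 / c)\<close>, uniformly in \<open>y\<close>
  (lemma \<open>infinite_cheap_two_hop_paths\<close>).

  Relays exist outside every finite set, almost surely. Pick \<open>g > \<gamma>\<close> with \<open>\<alpha> * g < d\<close>, which is
  possible as \<open>\<alpha> < d / \<gamma>\<close>. A vertex of the box \<open>{1..n}\<^sup>d\<close> has norm at most \<open>d * n\<close>, hence is a relay
  with probability at least of order \<open>n\<^sup>-\<^sup>\<alpha>\<^sup>g\<close>. For distinct \<open>y \<notin> {0, x}\<close> the relay
  events involve disjoint sets of weights and noises, so they are independent, and all the roughly
  \<open>n\<^sup>d\<close> vertices of the box fail with probability at most \<open>exp (- a * n\<^sup>d\<^sup>-\<^sup>\<alpha>\<^sup>g)\<close>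
  for some \<open>a > 0\<close>, which tends to \<open>0\<close> (lemma \<open>relay_AE\<close>). Countably many sets, levels and targets
  \<open>x\<close> cost nothing.

  The other half is that no path between distinct vertices has time \<open>0\<close>. The noises are almost
  surely positive since an atom of \<open>\<omega>\<close> at \<open>0\<close> would keep \<open>ln P(\<omega> \<le> r)\<close> bounded as \<open>r\<close> tends to \<open>0\<close>
  and so force \<open>\<theta> = 0\<close> (lemma \<open>\<omega>_no_atom_at_0\<close>). Positivity and the infinitely many cheap two-hop
  paths determine the hop counts deterministically (lemma \<open>hop_structure\<close>), because the only one-hop
  path is the direct edge.
\<close>

section \<open>Norms, edges and short paths\<close>

lemma l1_norm_nonneg: "0 \<le> l1_norm x"
  unfolding l1_norm_def by (intro sum_nonneg) simp

lemma l1_norm_pos: "x \<noteq> 0 \<Longrightarrow> 0 < l1_norm x"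
proof -
  assume "x \<noteq> 0"
  then obtain i where "x $ i \<noteq> 0"
    by (auto simp: vec_eq_iff)
  then show ?thesis
    unfolding l1_norm_def by (intro sum_pos2[of UNIV i]) auto
qed

lemma l1_norm_triangle: "l1_norm (x - y) \<le> l1_norm x + l1_norm y"
  unfolding l1_norm_def by (simp flip: sum.distrib add: sum_mono abs_triangle_ineq4)

lemma edge_time_pos:
  assumes "x \<noteq> y" "v x > 0" "v y > 0" "w {x, y} > 0"
  shows "edge_time \<alpha> v w x y > 0"
  using l1_norm_pos[of "x - y"] assms by (simp add: edge_time_def)

lemma hop_count_pos:
  assumes "p \<in> paths x y" "x \<noteq> y"
  shows "hop_count p > 0"
  using assms by (cases p) (auto simp: paths_def hop_count_def split: if_splits)

lemma path_time_pos:
  assumes pos: "\<And>x y. x \<noteq> y \<Longrightarrow> edge_time \<alpha> v w x y > 0"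
    and p: "p \<in> paths x y" "x \<noteq> y"
  shows "path_time \<alpha> v w p > 0"
proof -
  have "edge_time \<alpha> v w (p ! i) (p ! Suc i) > 0" if "i < hop_count p" for i
    using that p by (intro pos) (auto simp: paths_def hop_count_def nth_eq_iff_index_eq)
  then show ?thesis
    unfolding path_time_def using hop_count_pos[OF p] by (intro sum_pos) auto
qed

lemma single_edge_path:
  assumes "x \<noteq> y"
  shows "[x, y] \<in> paths x y" "hop_count [x, y] = 1"
    "path_time \<alpha> v w [x, y] = edge_time \<alpha> v w x y"
  using assms by (auto simp: paths_def hop_count_def path_time_def)

lemma two_edge_path:
  assumes "x \<noteq> y" "z \<noteq> x" "z \<noteq> y"
  shows "[x, z, y] \<in> paths x y" "hop_count [x, z, y] = 2"
    "path_time \<alpha> v w [x, z, y] = edge_time \<alpha> v w x z + edge_time \<alpha> v w z y"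
  using assms by (auto simp: paths_def hop_count_def path_time_def numeral_2_eq_2)

lemma hop_count_1_path:
  assumes "p \<in> paths x y" "hop_count p = 1"
  shows "p = [x, y]"
proof -
  have "length p = 2"
    using assms by (cases p) (auto simp: paths_def hop_count_def)
  then obtain a b where "p = [a, b]"
    by (auto simp: numeral_2_eq_2 length_Suc_conv)
  then show ?thesis
    using assms by (auto simp: paths_def)
qed

text \<open>
  The probabilistic input is confined to the two hypotheses: positive edge times exclude budget \<open>0\<close>
  and an attained infimum, while cheap two-hop paths give the upper bound \<open>2\<close> and the infimum \<open>0\<close>.
  For a budget below the time of the direct edge, one hop is too expensive.
\<close>

lemma hop_structure:
  fixes x :: "int ^ 'd"
  assumes pos: "\<And>x y. x \<noteq> y \<Longrightarrow> edge_time \<alpha> v w x y > 0"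
    and inf: "\<And>t. t > 0 \<Longrightarrow> infinite {p \<in> paths 0 x. hop_count p = 2 \<and> path_time \<alpha> v w p \<le> t}"
    and x: "x \<noteq> 0"
  shows "min_hops \<alpha> v w x 0 = \<infinity>"
    and "\<lbrakk>0 < t; t < edge_time \<alpha> v w 0 x\<rbrakk> \<Longrightarrow> min_hops \<alpha> v w x t = 2"
    and "edge_time \<alpha> v w 0 x \<le> t \<Longrightarrow> min_hops \<alpha> v w x t = 1"
    and "first_passage_time \<alpha> v w 0 x = 0"
    and "p \<in> paths 0 x \<Longrightarrow> ereal (path_time \<alpha> v w p) \<noteq> first_passage_time \<alpha> v w 0 x"
proof -
  have time_pos: "path_time \<alpha> v w p > 0" if "p \<in> paths 0 x" for p
    using path_time_pos[OF pos that] x by simp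
  have ex2: "\<exists>p\<in>paths 0 x. hop_count p = 2 \<and> path_time \<alpha> v w p \<le> t" if "t > 0" for t
    using infinite_imp_nonempty[OF inf[OF that]] by blast
  have "{p \<in> paths 0 x. path_time \<alpha> v w p \<le> 0} = {}"
    using time_pos by force
  then show "min_hops \<alpha> v w x 0 = \<infinity>"
    by (simp only: min_hops_def) (simp add: top_enat_def)
  show "min_hops \<alpha> v w x t = 1" if t: "edge_time \<alpha> v w 0 x \<le> t" for t
  proof (rule antisym)
    show "min_hops \<alpha> v w x t \<le> 1"
      unfolding min_hops_def using single_edge_path[of 0 x] x t
      by (intro INF_lower2[of "[0, x]"]) (auto simp: one_enat_def)
    show "1 \<le> min_hops \<alpha> v w x t"
      unfolding min_hops_def using hop_count_pos x
      by (intro INF_greatest) (fastforce simp: one_enat_def)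
  qed
  show "min_hops \<alpha> v w x t = 2" if t: "0 < t" "t < edge_time \<alpha> v w 0 x" for t
  proof (rule antisym)
    obtain q where "q \<in> paths 0 x" "hop_count q = 2" "path_time \<alpha> v w q \<le> t"
      using ex2[OF t(1)] by blast
    then show "min_hops \<alpha> v w x t \<le> 2"
      unfolding min_hops_def by (intro INF_lower2[of q]) (auto simp: numeral_eq_enat)
    have "hop_count q \<ge> 2" if "q \<in> paths 0 x" "path_time \<alpha> v w q \<le> t" for q
    proof -
      have "hop_count q \<noteq> 1"
        using hop_count_1_path[OF that(1)] that(2) t single_edge_path(3)[of 0 x \<alpha> v w] x by auto
      then show ?thesis
        using hop_count_pos[OF that(1)] x by auto
    qed
    then show "2 \<le> min_hops \<alpha> v w x t"
      unfolding min_hops_def by (intro INF_greatest) (auto simp: numeral_eq_enat)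
  qed
  have fpt: "first_passage_time \<alpha> v w 0 x = 0"
  proof (rule antisym)
    show "first_passage_time \<alpha> v w 0 x \<le> 0"
    proof (rule ereal_le_epsilon2)
      show "first_passage_time \<alpha> v w 0 x \<le> 0 + ereal e" if "0 < e" for e
        using that ex2 unfolding first_passage_time_def by (fastforce intro: INF_lower2)
    qed
    show "0 \<le> first_passage_time \<alpha> v w 0 x"
      unfolding first_passage_time_def using time_pos by (intro INF_greatest) (simp add: less_imp_le)
  qed
  show "first_passage_time \<alpha> v w 0 x = 0"
    by (fact fpt)
  show "ereal (path_time \<alpha> v w p) \<noteq> first_passage_time \<alpha> v w 0 x" if "p \<in> paths 0 x" for p
    using time_pos[OF that] fpt by simp
qed

text \<open>
  It suffices to find relays of every level outside every finite set: were the set of cheap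
  intermediate vertices finite, a relay outside of it of sufficiently high level would be cheap too.
\<close>

lemma infinite_cheap_two_hop_paths:
  fixes x :: "int ^ 'd"
  assumes \<alpha>: "\<alpha> > 0" and v: "\<And>y. v y > 0" and K: "K > 0" and x: "x \<noteq> 0" and t: "t > 0"
    and relay: "\<And>F c. finite F \<Longrightarrow> \<exists>y. y \<notin> F \<and> real (c::nat) * real_of_int (l1_norm y) powr \<alpha> \<le> v y
                   \<and> w {0, y} \<le> K \<and> w {y, x} \<le> K"
  shows "infinite {p \<in> paths 0 x. hop_count p = 2 \<and> path_time \<alpha> v w p \<le> t}"
proof -
  \<comment> \<open>a two-hop path through a relay of level \<open>c\<close> takes time at most \<open>C / c\<close>; the factor
    \<open>(1 + l1_norm x) powr \<alpha>\<close> comes from \<open>l1_norm (y - x) \<le> (1 + l1_norm x) * l1_norm y\<close>\<close>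
  define C where "C = K / v 0 + (1 + l1_norm x) powr \<alpha> * K / v x"
  obtain c :: nat where c: "C / t < c"
    using reals_Archimedean2 by blast
  have C: "C > 0"
    unfolding C_def using K v l1_norm_nonneg[of x] by (intro add_pos_pos) auto
  have "c > 0"
    using c C t by (metis divide_pos_pos of_nat_0_less_iff order_less_trans)
  define Y where "Y = {y. y \<noteq> 0 \<and> y \<noteq> x \<and> path_time \<alpha> v w [0, y, x] \<le> t}"
  have "infinite Y"
  proof
    assume "finite Y"
    then obtain y where y: "y \<notin> Y \<union> {0, x}" "c * l1_norm y powr \<alpha> \<le> v y"
        "w {0, y} \<le> K" "w {y, x} \<le> K"
      using relay[of "Y \<union> {0, x}" c] by auto
    define r where "r = real_of_int (l1_norm y)"
    have r: "r \<ge> 1"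
      using l1_norm_pos[of y] y(1) by (auto simp: r_def)
    have vy: "c * r powr \<alpha> \<le> v y"
      using y(2) by (simp add: r_def)
    have e0: "edge_time \<alpha> v w 0 y \<le> K / v 0 / c"
    proof -
      have "l1_norm (0 - y) = l1_norm y"
        by (simp add: l1_norm_def)
      then have "edge_time \<alpha> v w 0 y = r powr \<alpha> * w {0, y} / (v 0 * v y)"
        by (simp add: edge_time_def r_def)
      also have "\<dots> \<le> r powr \<alpha> * K / (v 0 * v y)"
        using y(3) v by (intro divide_right_mono mult_left_mono) (auto simp: less_imp_le)
      also have "\<dots> \<le> r powr \<alpha> * K / (v 0 * (c * r powr \<alpha>))"
        using vy v K \<open>c > 0\<close> r
        by (intro divide_left_mono mult_left_mono mult_pos_pos) (auto simp: less_imp_le)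
      finally show ?thesis
        using r by simp
    qed
    have ex: "edge_time \<alpha> v w y x \<le> (1 + l1_norm x) powr \<alpha> * K / v x / c"
    proof -
      have "real_of_int (l1_norm (y - x)) \<le> r + l1_norm x"
        using l1_norm_triangle[of y x] unfolding r_def by linarith
      also have "\<dots> \<le> (1 + l1_norm x) * r"
        using mult_left_mono[OF r, of "l1_norm x"] l1_norm_nonneg[of x] by (simp add: algebra_simps)
      finally have "l1_norm (y - x) powr \<alpha> \<le> ((1 + l1_norm x) * r) powr \<alpha>"
        using l1_norm_nonneg[of "y - x"] \<alpha> by (intro powr_mono2) auto
      also have "\<dots> = (1 + l1_norm x) powr \<alpha> * r powr \<alpha>"
        using l1_norm_nonneg[of x] r by (subst powr_mult) auto
      finally have n: "l1_norm (y - x) powr \<alpha> \<le> (1 + l1_norm x) powr \<alpha> * r powr \<alpha>" .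
      have "edge_time \<alpha> v w y x \<le> l1_norm (y - x) powr \<alpha> * K / (v y * v x)"
        unfolding edge_time_def
        using y(4) v by (intro divide_right_mono mult_left_mono) (auto simp: less_imp_le)
      also have "\<dots> \<le> (1 + l1_norm x) powr \<alpha> * r powr \<alpha> * K / (v y * v x)"
        using n v K by (intro divide_right_mono mult_right_mono) (auto simp: less_imp_le)
      also have "\<dots> \<le> (1 + l1_norm x) powr \<alpha> * r powr \<alpha> * K / ((c * r powr \<alpha>) * v x)"
        using vy v K \<open>c > 0\<close> r
        by (intro divide_left_mono mult_right_mono mult_pos_pos mult_nonneg_nonneg) (auto simp: less_imp_le)
      finally show ?thesis
        using r by (simp add: field_simps)
    qed
    have "path_time \<alpha> v w [0, y, x] \<le> C / c"
      using e0 ex two_edge_path(3)[of 0 x y \<alpha> v w] x y(1) by (auto simp: C_def add_divide_distrib)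
    also have "\<dots> \<le> t"
      using c t \<open>c > 0\<close> by (simp add: field_simps)
    finally show False
      using y(1) by (auto simp: Y_def)
  qed
  moreover have "inj_on (\<lambda>y. [0, y, x]) Y"
    by (auto simp: inj_on_def)
  ultimately have "infinite ((\<lambda>y. [0, y, x]) ` Y)"
    by (simp add: finite_image_iff)
  moreover have "(\<lambda>y. [0, y, x]) ` Y \<subseteq> {p \<in> paths 0 x. hop_count p = 2 \<and> path_time \<alpha> v w p \<le> t}"
    using two_edge_path[of 0 x] x by (auto simp: Y_def)
  ultimately show ?thesis
    using finite_subset by blast
qed

section \<open>Boxes in the lattice\<close>

definition box :: "nat \<Rightarrow> (int ^ 'd) set" where
  "box n = {y. \<forall>i. y $ i \<in> {1..int n}}"

lemma box_eq_image: "box n = vec_lambda ` (UNIV \<rightarrow>\<^sub>E {1..int n})"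
proof (intro set_eqI iffI)
  fix y :: "int ^ 'd" assume "y \<in> box n"
  then show "y \<in> vec_lambda ` (UNIV \<rightarrow>\<^sub>E {1..int n})"
    by (intro image_eqI[of _ _ "vec_nth y"]) (auto simp: box_def)
qed (force simp: box_def)

lemma finite_box: "finite (box n)"
  unfolding box_eq_image by (intro finite_imageI finite_PiE) auto

lemma card_box: "card (box n :: (int ^ 'd) set) = n ^ CARD('d)"
proof -
  have "inj_on vec_lambda (UNIV \<rightarrow>\<^sub>E {1..int n} :: ('d \<Rightarrow> int) set)"
    by (auto simp: inj_on_def vec_lambda_inject)
  then show ?thesis
    unfolding box_eq_image by (simp add: card_image card_PiE)
qed

lemma l1_norm_box:
  fixes y :: "int ^ 'd"
  assumes "y \<in> box n"
  shows "l1_norm y \<le> int CARD('d) * int n"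
proof -
  have "l1_norm y \<le> (\<Sum>i\<in>(UNIV::'d set). int n)"
    unfolding l1_norm_def using assms
    by (intro sum_mono) (smt (verit) atLeastAtMost_iff box_def mem_Collect_eq)
  then show ?thesis by simp
qed

section \<open>The one-dimensional laws\<close>

lemma edgeI: "x \<noteq> y \<Longrightarrow> {x, y} \<in> edges"
  by (auto simp: edges_def)

context ilrfpp
begin

lemma V_measurable: "V x \<in> borel_measurable M"
  using indep by (auto simp: indep_vars_def2 dest: bspec[of _ _ "Inl x"])

lemma \<omega>_measurable: "e \<in> edges \<Longrightarrow> \<omega> e \<in> borel_measurable M"
  using indep by (auto simp: indep_vars_def2 dest: bspec[of _ _ "Inr e"])

lemma V_pos_AE: "AE s in M. V x s > 0"
  using V_pos V_measurable[of x] unfolding law_V[of x, symmetric]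
  by (subst (asm) AE_distr_iff) auto

lemma measure_LV: "A \<in> sets borel \<Longrightarrow> measure LV A = prob (V x -` A \<inter> space M)"
  unfolding law_V[of x, symmetric] by (intro measure_distr V_measurable)

lemma measure_L\<omega>: "e \<in> edges \<Longrightarrow> A \<in> sets borel \<Longrightarrow> measure L\<omega> A = prob (\<omega> e -` A \<inter> space M)"
  by (subst law_\<omega>[symmetric]) (auto intro!: measure_distr \<omega>_measurable)

text \<open>
  The tail exponent \<open>\<gamma>\<close> is known on a logarithmic scale only; an arbitrarily small loss in the
  exponent absorbs the subpolynomial correction.
\<close>

lemma V_tail_lower:
  assumes "\<gamma> < g"
  shows "\<forall>\<^sub>F r in at_top. r powr - g \<le> measure LV {r..}"
proof -
  have "\<forall>\<^sub>F r in at_top. ln (measure LV {r..}) / ln r > - g"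
    using V_tail assms by (intro order_tendstoD(1)) auto
  moreover have "\<forall>\<^sub>F r in at_top. ln (measure LV {r..}) / ln r < 0"
    using V_tail pos by (intro order_tendstoD(2)) auto
  ultimately show ?thesis
    using eventually_gt_at_top[of 1]
  proof eventually_elim
    case (elim r)
    \<comment> \<open>as \<open>ln 0 = 0\<close>, a vanishing probability would make the quotient \<open>0\<close>\<close>
    have m: "measure LV {r..} > 0"
      using elim(2) measure_nonneg[of LV "{r..}"] by (metis div_0 ln_0 order_le_less)
    have "- g * ln r < ln (measure LV {r..})"
      using elim(1,3) by (simp add: field_simps)
    then have "exp (- g * ln r) < exp (ln (measure LV {r..}))"
      by simp
    then show ?case
      using m elim(3) by (simp add: powr_def)
  qed
qed

lemma \<omega>_lower_tail_pos: "\<exists>K>0. measure L\<omega> {..K} > 0"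
proof -
  have "\<forall>\<^sub>F r in at_right 0. ln (measure L\<omega> {..r}) / ln r > 0"
    using \<omega>_tail pos(3) by (rule order_tendstoD(1))
  then have "\<forall>\<^sub>F r in at_right 0. r > 0 \<and> ln (measure L\<omega> {..r}) / ln r > 0"
    using eventually_at_right_less by eventually_elim auto
  then obtain r where r: "r > 0" "ln (measure L\<omega> {..r}) / ln r > 0"
    using eventually_happens trivial_limit_at_right_real by blast
  then have "measure L\<omega> {..r} \<noteq> 0"
    by auto
  then show ?thesis
    using r(1) by (intro exI[of _ r]) (simp add: zero_less_measure_iff)
qed

text \<open>
  With an atom at \<open>0\<close> the numerator of \<open>ln P(\<omega> \<le> r) / ln r\<close> stays between \<open>ln P(\<omega> \<le> 0)\<close> and \<open>0\<close>
  while the denominator diverges, so the limit would be \<open>0\<close> instead of \<open>\<theta>\<close>.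
\<close>

lemma \<omega>_no_atom_at_0:
  fixes e :: "(int ^ 'd) set"
  assumes "e \<in> edges"
  shows "measure L\<omega> {..0} = 0"
proof (rule ccontr)
  interpret L: prob_space L\<omega>
    using prob_space_distr[OF \<omega>_measurable[OF assms]] law_\<omega>[OF assms] by simp
  have [simp]: "sets L\<omega> = sets borel"
    using law_\<omega>[OF assms] by (metis sets_distr)
  assume "measure L\<omega> {..0} \<noteq> 0"
  then have c: "measure L\<omega> {..0} > 0"
    using measure_nonneg[of L\<omega> "{..0}"] by linarith
  have mono: "measure L\<omega> {..0} \<le> measure L\<omega> {..r}" if "r > 0" for r
    using that by (intro L.finite_measure_mono) auto
  have "((\<lambda>r. ln (measure L\<omega> {..r}) / ln r) \<longlongrightarrow> 0) (at_right 0)"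
  proof (rule Lim_null_comparison)
    have "\<forall>\<^sub>F r in at_right (0::real). 0 < r \<and> r < 1"
      using eventually_at_right_real[of 0 1] by simp
    then show "\<forall>\<^sub>F r in at_right 0.
        norm (ln (measure L\<omega> {..r}) / ln r) \<le> \<bar>ln (measure L\<omega> {..0})\<bar> / \<bar>ln r\<bar>"
    proof eventually_elim
      case (elim r)
      have "ln (measure L\<omega> {..0}) \<le> ln (measure L\<omega> {..r})" "ln (measure L\<omega> {..r}) \<le> 0"
        using mono[of r] c elim L.prob_le_1[of "{..r}"] by auto
      then show ?case
        by (auto intro!: divide_right_mono)
    qed
    show "((\<lambda>r. \<bar>ln (measure L\<omega> {..0})\<bar> / \<bar>ln r\<bar>) \<longlongrightarrow> 0) (at_right 0)"
      by real_asymp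
  qed
  then show False
    using tendsto_unique[OF _ \<omega>_tail] pos by fastforce
qed

lemma \<omega>_pos_AE:
  fixes e :: "(int ^ 'd) set"
  assumes "e \<in> edges"
  shows "AE s in M. \<omega> e s > 0"
proof -
  have "prob (\<omega> e -` {..0} \<inter> space M) = 0"
    using \<omega>_no_atom_at_0[OF assms] measure_L\<omega>[OF assms, of "{..0}"] by simp
  then have "AE s in M. s \<notin> \<omega> e -` {..0} \<inter> space M"
    using \<omega>_measurable[OF assms] by (subst (asm) prob_eq_0) auto
  then show ?thesis
    using AE_space by eventually_elim auto
qed

section \<open>Relays exist almost surely\<close>

definition relay :: "real \<Rightarrow> real \<Rightarrow> int ^ 'd \<Rightarrow> int ^ 'd \<Rightarrow> 'a set" where
  "relay c K x y = {s \<in> space M. c * l1_norm y powr \<alpha> \<le> V y s \<and> \<omega> {0, y} s \<le> K \<and> \<omega> {y, x} s \<le> K}"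

lemma relay_event:
  assumes "y \<noteq> 0" "y \<noteq> x"
  shows "relay c K x y \<in> events"
proof -
  have [measurable]: "V y \<in> borel_measurable M" "\<omega> {0, y} \<in> borel_measurable M" "\<omega> {y, x} \<in> borel_measurable M"
    using assms by (auto intro!: V_measurable \<omega>_measurable edgeI)
  show ?thesis
    unfolding relay_def by measurable
qed

lemma prob_relay:
  assumes "x \<noteq> 0" "y \<noteq> 0" "y \<noteq> x"
  shows "prob (relay c K x y) = measure LV {c * l1_norm y powr \<alpha>..} * measure L\<omega> {..K} ^ 2"
proof -
  define J where "J = {Inl y, Inr {0, y}, Inr {y, x}}"
  define A where "A = case_sum (\<lambda>_::int ^ 'd. {c * l1_norm y powr \<alpha>..}) (\<lambda>_::(int ^ 'd) set. {..K})"
  have e: "{0, y} \<in> edges" "{y, x} \<in> edges"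
    using assms by (auto intro!: edgeI)
  have ne: "{0, y} \<noteq> {y, x}"
    using assms by (auto simp: doubleton_eq_iff)
  have "relay c K x y = (\<Inter>i\<in>J. case_sum V \<omega> i -` A i \<inter> space M)"
    by (auto simp: relay_def J_def A_def)
  also have "prob \<dots> = (\<Prod>i\<in>J. prob (case_sum V \<omega> i -` A i \<inter> space M))"
    using e by (intro indep_varsD[OF indep]) (auto simp: J_def A_def)
  also have "\<dots> = measure LV {c * l1_norm y powr \<alpha>..} * measure L\<omega> {..K} ^ 2"
    using ne e by (simp add: J_def A_def measure_LV[of _ y] flip: measure_L\<omega>)
      (simp add: power2_eq_square)
  finally show ?thesis .
qed

text \<open>
  The event of being a relay between \<open>0\<close> and \<open>x\<close> is determined by the weight at \<open>y\<close> and the noises on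
  \<open>{0, y}\<close> and \<open>{y, x}\<close>. These index sets are disjoint for different \<open>y\<close>, because an
  edge \<open>{0, y}\<close> could only equal \<open>{y', x}\<close> if \<open>y = x\<close> or \<open>x = 0\<close>; grouping the jointly
  independent family accordingly makes the relay events independent.
\<close>

lemma prob_no_relay:
  assumes x: "x \<noteq> 0" and S: "finite S" "0 \<notin> S" "x \<notin> S"
  shows "prob (space M - (\<Union>y\<in>S. relay c K x y)) = (\<Prod>y\<in>S. 1 - prob (relay c K x y))"
proof (cases "S = {}")
  case True
  then show ?thesis by (simp add: prob_space)
next
  case False
  define J where "J y = {Inl y, Inr {0, y}, Inr {y, x}}" for y
  define X where "X y s = restrict (\<lambda>i. case_sum V \<omega> i s) (J y)" for y s
  define A where "A y = {f \<in> space (PiM (J y) (\<lambda>_. borel)).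
    \<not> (c * l1_norm y powr \<alpha> \<le> f (Inl y) \<and> f (Inr {0, y}) \<le> K \<and> f (Inr {y, x}) \<le> K)}" for y
  have indep_X: "indep_vars (\<lambda>y. PiM (J y) (\<lambda>_. borel)) X S"
    unfolding X_def
  proof (rule indep_vars_restrict[OF indep])
    show "J y \<subseteq> UNIV <+> edges" if "y \<in> S" for y
      using that S by (auto simp: J_def intro!: edgeI)
    show "disjoint_family_on J S"
      using S x by (auto simp: disjoint_family_on_def J_def doubleton_eq_iff)
  qed
  have A: "A y \<in> sets (PiM (J y) (\<lambda>_. borel))" for y
    unfolding A_def J_def by measurable
  have X_A: "X y -` A y \<inter> space M = space M - relay c K x y" for y
    by (auto simp: X_def A_def relay_def J_def space_PiM)
  have "space M - (\<Union>y\<in>S. relay c K x y) = (\<Inter>y\<in>S. X y -` A y \<inter> space M)"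
    using False unfolding X_A by auto
  also have "prob \<dots> = (\<Prod>y\<in>S. prob (X y -` A y \<inter> space M))"
    using False S A by (intro indep_varsD[OF indep_X]) auto
  also have "\<dots> = (\<Prod>y\<in>S. 1 - prob (relay c K x y))"
    unfolding X_A using S by (intro prod.cong refl prob_compl relay_event) auto
  finally show ?thesis .
qed

text \<open>
  If there are no relays outside \<open>F \<union> {0, x}\<close>, then for every \<open>n\<close> there are none in
  \<open>box n - (F \<union> {0, x})\<close>. The probability of the latter tends to \<open>0\<close> because the number of candidates, of order
  \<open>n powr d\<close>, beats the inverse of the individual success probability, of order \<open>n powr (\<alpha> * g)\<close>.
\<close>

lemma relay_AE:
  assumes \<alpha>: "\<alpha> < real CARD('d) / \<gamma>" and K: "measure L\<omega> {..K} > 0" and c: "c > 0"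
    and x: "x \<noteq> 0" and F: "finite F"
  shows "AE s in M. \<exists>y. y \<notin> F \<and> s \<in> relay c K x y"
proof -
  define d where "d = real CARD('d)"
  define q where "q = measure L\<omega> {..K}"
  define S where "S n = box n - (F \<union> {0, x})" for n
  define m where "m = real (card (F \<union> {0, x}))"
  define r where "r n = c * (d * real n) powr \<alpha>" for n
  \<comment> \<open>\<open>r n\<close> bounds the weight that a vertex of \<open>box n\<close> needs in order to be a relay\<close>
  define D where "D = space M - (\<Union>y\<in>- (F \<union> {0, x}). relay c K x y)"
  have "d \<ge> 1"
    unfolding d_def by (simp add: Suc_leI)
  have "\<gamma> < d / \<alpha>"
    using \<alpha> pos by (simp add: d_def field_simps)
  then obtain g where g: "\<gamma> < g" "g < d / \<alpha>"
    using dense by blast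
  then have \<alpha>g: "\<alpha> * g < d"
    using pos by (simp add: field_simps)
  have S: "finite (S n)" "0 \<notin> S n" "x \<notin> S n" for n
    by (auto simp: S_def finite_box)
  have card_S: "real n powr d - m \<le> card (S n)" if "n > 0" for n
  proof -
    have "n ^ CARD('d) - card (F \<union> {0, x}) \<le> card (S n)"
      using diff_card_le_card_Diff[of "F \<union> {0, x}" "box n :: (int ^ 'd) set"] F
      unfolding S_def card_box by simp
    then have "real (n ^ CARD('d)) - m \<le> card (S n)"
      unfolding m_def by linarith
    then show ?thesis
      using that by (simp add: d_def powr_realpow)
  qed
  have D_event: "D \<in> events"
    unfolding D_def by (intro sets.compl_sets sets.countable_UN') (auto intro: relay_event)
  have bound: "prob D \<le> exp (- (card (S n) * (measure LV {r n..} * q ^ 2)))" for n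
  proof -
    have "prob D \<le> prob (space M - (\<Union>y\<in>S n. relay c K x y))"
      using S by (intro finite_measure_mono sets.compl_sets sets.finite_UN relay_event)
        (auto simp: D_def S_def)
    also have "\<dots> = (\<Prod>y\<in>S n. 1 - prob (relay c K x y))"
      by (intro prob_no_relay x S)
    also have "\<dots> \<le> (\<Prod>y\<in>S n. exp (- (measure LV {r n..} * q ^ 2)))"
    proof (intro prod_mono conjI)
      fix y assume y: "y \<in> S n"
      show "0 \<le> 1 - prob (relay c K x y)"
        by simp
      have "real_of_int (l1_norm y) \<le> d * n"
        using l1_norm_box[of y n] y unfolding S_def d_def
        by (metis DiffD1 of_int_le_iff of_int_mult of_int_of_nat_eq)
      then have le: "c * l1_norm y powr \<alpha> \<le> r n"
        using c pos l1_norm_nonneg[of y] by (auto simp: r_def intro!: powr_mono2)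
      have "measure LV {r n..} \<le> measure LV {c * l1_norm y powr \<alpha>..}"
        unfolding measure_LV[of _ y, OF borel_closed[OF closed_atLeast]] using le
        by (intro finite_measure_mono measurable_sets[OF V_measurable]) auto
      then have "measure LV {r n..} * q ^ 2 \<le> prob (relay c K x y)"
        using y x by (auto simp: prob_relay S_def q_def intro!: mult_right_mono)
      then show "1 - prob (relay c K x y) \<le> exp (- (measure LV {r n..} * q ^ 2))"
        using exp_ge_add_one_self[of "- (measure LV {r n..} * q ^ 2)"] by linarith
    qed
    also have "\<dots> = exp (- (card (S n) * (measure LV {r n..} * q ^ 2)))"
      by (simp flip: exp_of_nat_mult)
    finally show ?thesis .
  qed
  have r_top: "filterlim r at_top sequentially"
    unfolding r_def using c \<open>d \<ge> 1\<close> pos by real_asymp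
  define a where "a = c powr - g * d powr - (\<alpha> * g) * q ^ 2"
  have a: "a > 0"
    using c \<open>d \<ge> 1\<close> K by (simp add: a_def q_def)
  have ge: "(real n powr d - m) * (a * real n powr - (\<alpha> * g)) \<le> card (S n) * (measure LV {r n..} * q ^ 2)"
    if n: "n > 0" and r: "r n powr - g \<le> measure LV {r n..}" for n
  proof -
    have "a * real n powr - (\<alpha> * g) = r n powr - g * q ^ 2"
      using c \<open>d \<ge> 1\<close> by (simp add: a_def r_def powr_mult powr_powr)
    also have "\<dots> \<le> measure LV {r n..} * q ^ 2"
      using r by (intro mult_right_mono) auto
    finally have "a * real n powr - (\<alpha> * g) \<le> measure LV {r n..} * q ^ 2" .
    then show ?thesis
      by (rule mult_mono[OF card_S[OF n]]) (use a in auto)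
  qed
  have "filterlim (\<lambda>n. (real n powr d - m) * (a * real n powr - (\<alpha> * g))) at_top sequentially"
    using a \<alpha>g \<open>d \<ge> 1\<close> by real_asymp
  then have "filterlim (\<lambda>n. card (S n) * (measure LV {r n..} * q ^ 2)) at_top sequentially"
  proof (rule filterlim_at_top_mono)
    have "\<forall>\<^sub>F n in sequentially. r n powr - g \<le> measure LV {r n..}"
      using V_tail_lower[OF g(1)] r_top by (rule eventually_compose_filterlim)
    then show "\<forall>\<^sub>F n in sequentially. (real n powr d - m) * (a * real n powr - (\<alpha> * g))
        \<le> card (S n) * (measure LV {r n..} * q ^ 2)"
      using eventually_gt_at_top[of 0] by eventually_elim (rule ge)
  qed
  then have "(\<lambda>n. exp (- (card (S n) * (measure LV {r n..} * q ^ 2)))) \<longlonglongrightarrow> 0"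
    by (intro filterlim_compose[OF exp_at_bot] filterlim_compose[OF filterlim_uminus_at_bot_at_top])
  then have "prob D \<le> 0"
    by (rule LIMSEQ_le_const) (use bound in auto)
  then have "AE s in M. s \<notin> D"
    using D_event prob_eq_0 by (simp add: measure_le_0_iff)
  then show ?thesis
    using AE_space by eventually_elim (auto simp: D_def)
qed

end

section \<open>Hop counts\<close>

theorem theorem2p2:
  fixes M :: "'a measure"
    and V :: "int ^ 'd \<Rightarrow> 'a \<Rightarrow> real"
    and \<omega> :: "(int ^ 'd) set \<Rightarrow> 'a \<Rightarrow> real"
    and LV L\<omega> :: "real measure"
    and \<alpha> \<gamma> \<theta> \<zeta> :: real
  assumes "ilrfpp M V \<omega> LV L\<omega> \<alpha> \<gamma> \<theta> \<zeta>"
    and "\<alpha> < real CARD('d) / \<gamma>"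
  shows "AE s in M.
    (let v = (\<lambda>x. V x s); w = (\<lambda>e. \<omega> e s) in
      \<forall>x. x \<noteq> 0 \<longrightarrow>
        min_hops \<alpha> v w x 0 = \<infinity> \<and>
        (\<forall>t. 0 < t \<and> t < edge_time \<alpha> v w 0 x \<longrightarrow> min_hops \<alpha> v w x t = 2) \<and>
        (\<forall>t. 0 \<le> t \<and> edge_time \<alpha> v w 0 x \<le> t \<longrightarrow> min_hops \<alpha> v w x t = 1) \<and>
        first_passage_time \<alpha> v w 0 x = 0 \<and>
        \<not> (\<exists>p\<in>paths 0 x. ereal (path_time \<alpha> v w p) = first_passage_time \<alpha> v w 0 x) \<and>
        (\<forall>t. 0 < t \<and> t < edge_time \<alpha> v w 0 x \<longrightarrow>
          infinite {p \<in> paths 0 x. hop_count p = 2 \<and> path_time \<alpha> v w p \<le> t}))"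
proof -
  interpret ilrfpp M V \<omega> LV L\<omega> \<alpha> \<gamma> \<theta> \<zeta>
    by fact
  obtain K where K: "K > 0" "measure L\<omega> {..K} > 0"
    using \<omega>_lower_tail_pos by blast
  have "AE s in M. \<forall>y. V y s > 0"
    unfolding AE_all_countable using V_pos_AE by blast
  moreover have "AE s in M. \<forall>x y. x \<noteq> y \<longrightarrow> \<omega> {x, y} s > 0"
    unfolding AE_all_countable by (auto intro: \<omega>_pos_AE edgeI)
  \<comment> \<open>levels \<open>Suc c\<close>, as a relay is guaranteed at positive levels\<close>
  moreover have "AE s in M. \<forall>x. x \<noteq> 0 \<longrightarrow> (\<forall>F\<in>Collect finite. \<forall>c::nat. \<exists>y. y \<notin> F \<and> s \<in> relay (Suc c) K x y)"
    unfolding AE_all_countable AE_ball_countable[OF countable_Collect_finite]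
    by (intro allI AE_impI AE_ball_countable' countable_Collect_finite)
      (auto simp: AE_all_countable intro!: relay_AE assms K)
  ultimately show ?thesis
  proof eventually_elim
    case (elim s)
    let ?v = "\<lambda>x. V x s" and ?w = "\<lambda>e. \<omega> e s"
    have pos: "edge_time \<alpha> ?v ?w x y > 0" if "x \<noteq> y" for x y
      using that elim by (intro edge_time_pos) auto
    have inf: "infinite {p \<in> paths 0 x. hop_count p = 2 \<and> path_time \<alpha> ?v ?w p \<le> t}"
      if x: "x \<noteq> 0" and t: "t > 0" for x t
    proof (rule infinite_cheap_two_hop_paths)
      fix F :: "(int ^ 'd) set" and c :: nat
      assume "finite F"
      then obtain y where "y \<notin> F" "s \<in> relay (Suc c) K x y"
        using elim(3) x by blast
      moreover have "c * l1_norm y powr \<alpha> \<le> Suc c * l1_norm y powr \<alpha>"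
        by (intro mult_right_mono) auto
      ultimately show "\<exists>y. y \<notin> F \<and> c * l1_norm y powr \<alpha> \<le> V y s \<and> \<omega> {0, y} s \<le> K \<and> \<omega> {y, x} s \<le> K"
        by (intro exI[of _ y]) (auto simp: relay_def)
    qed (use elim x t K ilrfpp_axioms in \<open>auto simp: ilrfpp_def ilrfpp_axioms_def\<close>)
    show ?case
      unfolding Let_def using hop_structure[OF pos inf] inf by blast
  qed
qed

end
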